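(* For a gain operator $\Gamma:\ell_\infty^+\to\ell_\infty^+$ with augmented gain operator $\hat\Gamma(s)=s\oplus\Gamma(s)$, consider the following statements: (a) $\Gamma$ satisfies the uniform small-gain condition. (b) $\Gamma$ satisfies the MBI property. (c) $\Gamma$ satisfies the $\oplus$-MBI property. (d) The system $s(k+1)=\hat\Gamma(s(k))$ is UGS and the system $s(k+1)=\Gamma(s(k))$ is globally componentwise attractive. (e) The system $s(k+1)=\hat\Gamma(s(k))$ is UGS and $\Gamma$ satisfies the small-gain condition (SGC). (f) The system $s(k+1)=\hat\Gamma(s(k))$ is UGS and $\Gamma$ has no non-zero fixed points. Then (a) $\Leftrightarrow$ (b) $\Rightarrow$ (c) $\Rightarrow$ (d) $\Leftrightarrow$ (e) $\Leftrightarrow$ (f), and the implication (c) $\Rightarrow$ (b) does not hold in general (there exist gain operators satisfying (c) but not (b)).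
   Context: $\mathbb{N}=\{1,2,\dots\}$, $\mathbb{R}_+=[0,\infty)$. $\ell_\infty$ is the Banach space of bounded real sequences with sup norm $\|\cdot\|_\infty$; $\ell_\infty^+$ is the cone of nonnegative sequences; $\le$ is the componentwise order; $\oplus$ is the componentwise maximum. For $I\subseteq\mathbb{N}$, $\ell_\infty^+(I)=\{s\in\ell_\infty^+: s_i=0\ \forall i\notin I\}$. $\mathrm{dist}(x,A)=\inf_{y\in A}\|x-y\|_\infty$. $\mathcal{K}$: continuous strictly increasing $\gamma:\mathbb{R}_+\to\mathbb{R}_+$ with $\gamma(0)=0$; $\mathcal{K}_\infty$: unbounded elements of $\mathcal{K}$. A monotone aggregation function (MAF) is $\mu:\ell_\infty^+\to[0,\infty]$ with $\mu(0)=0$; $s^1\le s^2\Rightarrow\mu(s^1)\le\mu(s^2)$; and $\mu$ finite-valued and continuous on $\ell_\infty^+(I)$ for every finite $I\subset\mathbb{N}$. Gain operator: for each $i\in\mathbb{N}$ one is given a finite set $I_i\subset\mathbb{N}\setminus\{i\}$, functions $\gamma_{ij}\in\mathcal{K}\cup\{0\}$ ($j\in\mathbb{N}$) with $\gamma_{ij}=0$ for $j\notin I_i$, and a MAF $\mu_i$; $\Gamma(s)=(\mu_i([\gamma_{ij}(s_j)]_{j\in\mathbb{N}}))_{i\in\mathbb{N}}$. Standing assumption: $\Gamma$ is well-defined (maps $\ell_\infty^+$ into itself) and norm-continuous. SGC: $\Gamma(s)\not\ge s$ for all $s\in\ell_\infty^+\setminus\{0\}$. Uniform small-gain condition: there is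 $\eta\in\mathcal{K}_\infty$ with $\mathrm{dist}(\Gamma(s)-s,\ell_\infty^+)\ge\eta(\|s\|_\infty)$ for all $s\in\ell_\infty^+$. MBI property: there is $\xi\in\mathcal{K}_\infty$ such that for all $s,b\in\ell_\infty^+$: $s-\Gamma(s)\le b\Rightarrow\|s\|_\infty\le\xi(\|b\|_\infty)$. $\oplus$-MBI property: there is $\varphi\in\mathcal{K}_\infty$ such that for all $s,b\in\ell_\infty^+$: $s\le\Gamma(s)\oplus b\Rightarrow\|s\|_\infty\le\varphi(\|b\|_\infty)$. The system $s(k+1)=T(s(k))$ for a monotone $T:\ell_\infty^+\to\ell_\infty^+$ is UGS (uniformly globally stable) if there is $\varphi\in\mathcal{K}_\infty$ with $\|T^k(s)\|_\infty\le\varphi(\|s\|_\infty)$ for all $s\in\ell_\infty^+$, $k\ge0$; it is globally componentwise attractive if for every $s\in\ell_\infty^+$ and $i\in\mathbb{N}$ the $i$th component of $T^k(s)$ tends to $0$ as $k\to\infty$. *)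

theory Defs
  imports "HOL-Analysis.Analysis"
begin

text \<open>The space of bounded real sequences with the sup norm: every function on the discrete
  space of naturals is continuous. Sequences are indexed from 0 instead of 1.\<close>

type_synonym linf = "nat \<Rightarrow>\<^sub>C real"

lemma apply_Bcontfun_bounded:
  fixes f :: "nat \<Rightarrow> real"
  assumes "bounded (range f)"
  shows "apply_bcontfun (Bcontfun f) = f"
  using assms by (simp add: Bcontfun_inverse bcontfun_def)

lemma apply_Bcontfun_finite_support:
  fixes f :: "nat \<Rightarrow> real"
  assumes "finite {j. f j \<noteq> 0}"
  shows "apply_bcontfun (Bcontfun f) = f"
proof (rule apply_Bcontfun_bounded)
  have "range f \<subseteq> insert 0 (f ` {j. f j \<noteq> 0})" by auto
  then show "bounded (range f)"
    by (rule bounded_subset[rotated]) (simp add: assms finite_imp_bounded)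
qed

definition linf_le :: "linf \<Rightarrow> linf \<Rightarrow> bool"  (infix "\<preceq>" 50)
  where "s \<preceq> t \<longleftrightarrow> (\<forall>i. s i \<le> t i)"

definition linf_max :: "linf \<Rightarrow> linf \<Rightarrow> linf"  (infixl "\<oplus>" 65)
  where "s \<oplus> t = Bcontfun (\<lambda>i. max (s i) (t i))"

lemma linf_max_apply: "(s \<oplus> t) i = max (s i) (t i)"
proof -
  have le: "norm (max (s j) (t j)) \<le> norm s + norm t" for j
  proof -
    have "norm (max (s j) (t j)) \<le> norm (s j) + norm (t j)"
      by (simp add: max_def)
    also have "\<dots> \<le> norm s + norm t"
      by (rule add_mono) (rule norm_bounded)+
    finally show ?thesis .
  qed
  have "bounded (range (\<lambda>i. max (s i) (t i)))"
    by (rule boundedI[where B = "norm s + norm t"]) (use le in blast)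
  then show ?thesis
    by (simp add: linf_max_def apply_Bcontfun_bounded)
qed

definition linf_cone :: "linf set"
  where "linf_cone = {s. 0 \<preceq> s}"

definition linf_cone_on :: "nat set \<Rightarrow> linf set"
  where "linf_cone_on I = {s \<in> linf_cone. \<forall>i. i \<notin> I \<longrightarrow> s i = 0}"

text \<open>Functions on the nonnegative reals are total functions of which only the values on
  \<open>{0..}\<close> matter.\<close>

definition class_K :: "(real \<Rightarrow> real) set"
  where "class_K = {\<gamma>. \<gamma> ` {0..} \<subseteq> {0..} \<and> continuous_on {0..} \<gamma> \<and>
    strict_mono_on {0..} \<gamma> \<and> \<gamma> 0 = 0}"

definition class_K_inf :: "(real \<Rightarrow> real) set"
  where "class_K_inf = {\<gamma> \<in> class_K. \<not> bounded (\<gamma> ` {0..})}"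

definition MAF :: "(linf \<Rightarrow> ennreal) \<Rightarrow> bool"
  where "MAF \<mu> \<longleftrightarrow>
    \<mu> 0 = 0 \<and>
    (\<forall>s\<in>linf_cone. \<forall>t\<in>linf_cone. s \<preceq> t \<longrightarrow> \<mu> s \<le> \<mu> t) \<and>
    (\<forall>I. finite I \<longrightarrow> (\<forall>s\<in>linf_cone_on I. \<mu> s < \<infinity>) \<and> continuous_on (linf_cone_on I) \<mu>)"

text \<open>\<open>\<Gamma>\<close> is the gain operator of the data \<open>I\<close>, \<open>\<gamma>\<close>, \<open>\<mu>\<close>, with well-definedness and continuity
  included; its values outside the cone are irrelevant. The sequence to which \<open>\<mu> i\<close> is applied is
  supported in the finite set \<open>I i\<close>, hence bounded, so \<open>Bcontfun\<close> is applied inside its domain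
  (see \<open>apply_Bcontfun_finite_support\<close>).\<close>

definition is_gain_operator ::
    "(nat \<Rightarrow> nat set) \<Rightarrow> (nat \<Rightarrow> nat \<Rightarrow> real \<Rightarrow> real) \<Rightarrow> (nat \<Rightarrow> linf \<Rightarrow> ennreal) \<Rightarrow>
      (linf \<Rightarrow> linf) \<Rightarrow> bool"
  where "is_gain_operator I \<gamma> \<mu> \<Gamma> \<longleftrightarrow>
    (\<forall>i. finite (I i) \<and> i \<notin> I i) \<and>
    (\<forall>i j. \<gamma> i j \<in> class_K \<or> (\<forall>r\<ge>0. \<gamma> i j r = 0)) \<and>
    (\<forall>i j. j \<notin> I i \<longrightarrow> (\<forall>r\<ge>0. \<gamma> i j r = 0)) \<and>
    (\<forall>i. MAF (\<mu> i)) \<and>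
    \<Gamma> ` linf_cone \<subseteq> linf_cone \<and>
    (\<forall>s\<in>linf_cone. \<forall>i. ennreal (\<Gamma> s i) = \<mu> i (Bcontfun (\<lambda>j. \<gamma> i j (s j)))) \<and>
    continuous_on linf_cone \<Gamma>"

definition augmented :: "(linf \<Rightarrow> linf) \<Rightarrow> linf \<Rightarrow> linf"
  where "augmented \<Gamma> s = s \<oplus> \<Gamma> s"

definition SGC :: "(linf \<Rightarrow> linf) \<Rightarrow> bool"
  where "SGC \<Gamma> \<longleftrightarrow> (\<forall>s\<in>linf_cone - {0}. \<not> s \<preceq> \<Gamma> s)"

definition uniform_SGC :: "(linf \<Rightarrow> linf) \<Rightarrow> bool"
  where "uniform_SGC \<Gamma> \<longleftrightarrow>
    (\<exists>\<eta>\<in>class_K_inf. \<forall>s\<in>linf_cone. infdist (\<Gamma> s - s) linf_cone \<ge> \<eta> (norm s))"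

definition MBI :: "(linf \<Rightarrow> linf) \<Rightarrow> bool"
  where "MBI \<Gamma> \<longleftrightarrow>
    (\<exists>\<xi>\<in>class_K_inf. \<forall>s\<in>linf_cone. \<forall>b\<in>linf_cone.
      s - \<Gamma> s \<preceq> b \<longrightarrow> norm s \<le> \<xi> (norm b))"

definition max_MBI :: "(linf \<Rightarrow> linf) \<Rightarrow> bool"
  where "max_MBI \<Gamma> \<longleftrightarrow>
    (\<exists>\<phi>\<in>class_K_inf. \<forall>s\<in>linf_cone. \<forall>b\<in>linf_cone.
      s \<preceq> \<Gamma> s \<oplus> b \<longrightarrow> norm s \<le> \<phi> (norm b))"

definition UGS :: "(linf \<Rightarrow> linf) \<Rightarrow> bool"
  where "UGS T \<longleftrightarrow>
    (\<exists>\<phi>\<in>class_K_inf. \<forall>s\<in>linf_cone. \<forall>k. norm ((T ^^ k) s) \<le> \<phi> (norm s))"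

definition componentwise_attractive :: "(linf \<Rightarrow> linf) \<Rightarrow> bool"
  where "componentwise_attractive T \<longleftrightarrow>
    (\<forall>s\<in>linf_cone. \<forall>i. (\<lambda>k. ((T ^^ k) s) i) \<longlonglongrightarrow> 0)"

definition no_nonzero_fixed_points :: "(linf \<Rightarrow> linf) \<Rightarrow> bool"
  where "no_nonzero_fixed_points \<Gamma> \<longleftrightarrow> \<not> (\<exists>s\<in>linf_cone - {0}. \<Gamma> s = s)"

end

theory Submission
  imports Defs
begin

text \<open>The distance of \<open>\<Gamma> s - s\<close> to the cone is the norm of the positive part of \<open>s - \<Gamma> s\<close>, so the
  uniform small-gain condition and the MBI property are each other's inverse, with
  \<open>\<xi> = \<eta>\<inverse>\<close>. The \<open>\<oplus>\<close>-MBI property bounds the augmented orbit, as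
  \<open>\<Gamma>\<^sub>a\<^sup>k s \<preceq> \<Gamma> (\<Gamma>\<^sub>a\<^sup>k s) \<oplus> s\<close> where \<open>\<Gamma>\<^sub>a = augmented \<Gamma>\<close>. Each component of \<open>\<Gamma>\<close> depends on finitely many
  coordinates, hence \<open>\<Gamma>\<close> is continuous along bounded componentwise convergent sequences. If the
  augmented system is UGS, its orbit from \<open>s\<close> increases to some \<open>t\<close> with \<open>\<Gamma> t \<preceq> t\<close>; the orbit
  \<open>\<Gamma>\<^sup>k t\<close> then decreases to a fixed point, which is zero, and it dominates \<open>\<Gamma>\<^sup>k s\<close>.

  Condition (c) does not imply (b) because of the weighted shift
  \<open>\<Gamma> s i = g (s (i + 1))\<close> with \<open>g r = r\<^sup>2 / (1 + r)\<close>: here \<open>g r < r\<close> for \<open>r > 0\<close>, but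
  \<open>r - g r = r / (1 + r)\<close> stays bounded.\<close>

section \<open>The cone, its order and the sup norm\<close>

lemma linf_cone_iff: "s \<in> linf_cone \<longleftrightarrow> (\<forall>i. 0 \<le> s i)"
  by (simp add: linf_cone_def linf_le_def)

lemma zero_in_linf_cone: "0 \<in> linf_cone"
  by (simp add: linf_cone_iff)

lemma linf_le_refl: "s \<preceq> s"
  by (simp add: linf_le_def)

lemma linf_le_trans: "s \<preceq> t \<Longrightarrow> t \<preceq> u \<Longrightarrow> s \<preceq> u"
  unfolding linf_le_def by (meson order_trans)

lemma linf_max_in_cone: "s \<in> linf_cone \<Longrightarrow> s \<oplus> t \<in> linf_cone"
  by (auto simp: linf_cone_iff linf_max_apply le_max_iff_disj)

lemma abs_apply_le_norm: "\<bar>(s :: linf) i\<bar> \<le> norm s"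
  using norm_bounded[of s i] by simp

lemma apply_le_norm: "(s :: linf) i \<le> norm s"
  using abs_apply_le_norm[of s i] by linarith

lemma norm_le_cone:
  assumes "s \<in> linf_cone" and "\<And>i. s i \<le> c"
  shows "norm s \<le> c"
  using assms by (intro norm_bound) (simp add: linf_cone_iff)

lemma continuous_on_linf_apply: "continuous_on A (\<lambda>s :: linf. s i)"
  unfolding continuous_on_iff by (meson dist_bounded le_less_trans)

lemma apply_Bcontfun_abs_le:
  fixes f :: "nat \<Rightarrow> real"
  assumes "\<And>i. \<bar>f i\<bar> \<le> B"
  shows "apply_bcontfun (Bcontfun f) = f"
  using assms by (intro apply_Bcontfun_bounded boundedI[where B = B]) auto

section \<open>Comparison functions and their inverses\<close>

lemma class_K_nonneg: "\<gamma> \<in> class_K \<Longrightarrow> 0 \<le> r \<Longrightarrow> 0 \<le> \<gamma> r"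
  unfolding class_K_def by auto

lemma class_K_less: "\<gamma> \<in> class_K \<Longrightarrow> 0 \<le> r \<Longrightarrow> r < t \<Longrightarrow> \<gamma> r < \<gamma> t"
  unfolding class_K_def strict_mono_on_def by auto

lemma class_K_mono: "\<gamma> \<in> class_K \<Longrightarrow> 0 \<le> r \<Longrightarrow> r \<le> t \<Longrightarrow> \<gamma> r \<le> \<gamma> t"
  using class_K_less[of \<gamma> r t] by (cases "r = t") auto

lemma class_K_zero: "\<gamma> \<in> class_K \<Longrightarrow> \<gamma> 0 = 0"
  unfolding class_K_def by auto

lemma class_K_inf_class_K: "\<gamma> \<in> class_K_inf \<Longrightarrow> \<gamma> \<in> class_K"
  unfolding class_K_inf_def by auto

text \<open>Unboundedness supplies a value of \<open>\<gamma>\<close> above \<open>y\<close>; since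
  \<open>\<gamma> 0 = 0\<close>, the intermediate value theorem does the rest.\<close>

lemma class_K_inf_surj:
  assumes "\<gamma> \<in> class_K_inf" and "0 \<le> y"
  obtains x where "0 \<le> x" and "\<gamma> x = y"
proof -
  have K: "\<gamma> \<in> class_K"
    using assms(1) by (rule class_K_inf_class_K)
  have "\<exists>x\<ge>0. y < \<gamma> x"
  proof (rule ccontr)
    assume "\<not> ?thesis"
    then have "\<bar>\<gamma> x\<bar> \<le> y" if "0 \<le> x" for x
      using that class_K_nonneg[OF K that] by (force simp: not_less)
    then have "bounded (\<gamma> ` {0..})"
      by (intro boundedI[where B = y]) auto
    then show False
      using assms(1) by (simp add: class_K_inf_def)
  qed
  then obtain x1 where x1: "0 \<le> x1" "y < \<gamma> x1" by blast
  have "continuous_on {0..x1} \<gamma>"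
    using K unfolding class_K_def by (auto intro: continuous_on_subset)
  then obtain x where "0 \<le> x" "x \<le> x1" "\<gamma> x = y"
    using IVT'[of \<gamma> 0 y x1] x1 assms(2) class_K_zero[OF K] by auto
  then show thesis using that by blast
qed

text \<open>This turns a lower bound by \<open>\<eta> (norm s)\<close> into an upper bound on
  \<open>norm s\<close> and back. The inverse inherits strict monotonicity from
  \<open>\<gamma>\<close>, and it is unbounded because it attains every nonnegative value.\<close>

lemma class_K_inf_inverse:
  assumes \<gamma>: "\<gamma> \<in> class_K_inf"
  obtains \<delta> where "\<delta> \<in> class_K_inf"
    and "\<And>r. 0 \<le> r \<Longrightarrow> \<delta> (\<gamma> r) = r" and "\<And>r. 0 \<le> r \<Longrightarrow> \<gamma> (\<delta> r) = r"
proof -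
  have K: "\<gamma> \<in> class_K"
    using \<gamma> by (rule class_K_inf_class_K)
  have "\<exists>x. 0 \<le> x \<and> \<gamma> x = y" if "0 \<le> y" for y
    using class_K_inf_surj[OF \<gamma> that] by blast
  then obtain h where h_nonneg: "\<And>y. 0 \<le> y \<Longrightarrow> 0 \<le> h y"
    and \<gamma>h: "\<And>y. 0 \<le> y \<Longrightarrow> \<gamma> (h y) = y"
    by metis
  have h\<gamma>: "h (\<gamma> x) = x" if "0 \<le> x" for x
  proof (rule ccontr)
    have nonneg: "0 \<le> \<gamma> x" "0 \<le> h (\<gamma> x)"
      using that by (auto intro: class_K_nonneg[OF K] h_nonneg)
    assume "h (\<gamma> x) \<noteq> x"
    then consider "h (\<gamma> x) < x" | "x < h (\<gamma> x)" by linarith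
    then show False
      using class_K_less[OF K nonneg(2), of x] class_K_less[OF K that, of "h (\<gamma> x)"]
        \<gamma>h[OF nonneg(1)] by cases auto
  qed
  have h_less: "h x < h y" if "0 \<le> x" "x < y" for x y
  proof (rule ccontr)
    assume "\<not> h x < h y"
    then have "\<gamma> (h y) \<le> \<gamma> (h x)"
      using that by (intro class_K_mono[OF K] h_nonneg) auto
    then show False using that by (simp add: \<gamma>h)
  qed
  have h0: "h 0 = 0"
    using h\<gamma>[of 0] class_K_zero[OF K] by simp
  \<comment> \<open>Extended by the identity, \<open>h\<close> is a monotone surjection of the real line, hence continuous.\<close>
  define H where "H y = (if y < 0 then y else h y)" for y :: real
  have "continuous_on UNIV H"
  proof (rule continuous_onI_mono)
    have "y \<in> range H" for y
    proof (cases "y < 0")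
      case True
      then have "y = H y" by (simp add: H_def)
      then show ?thesis by blast
    next
      case False
      then have "y = H (\<gamma> y)"
        using h\<gamma>[of y] class_K_nonneg[OF K, of y] by (simp add: H_def)
      then show ?thesis by blast
    qed
    then have "range H = UNIV" by blast
    then show "open (range H)" by simp
    show "H x \<le> H y" if "x \<le> y" for x y
      using that h_nonneg[of y] h_less[of x y] by (cases "x = y") (auto simp: H_def)
  qed
  then have "continuous_on {0..} H"
    by (rule continuous_on_subset) simp
  then have "continuous_on {0..} h"
    by (rule continuous_on_eq) (simp add: H_def)
  moreover have "\<not> bounded (h ` {0..})"
  proof
    assume "bounded (h ` {0..})"
    then obtain B where B: "\<And>x. 0 \<le> x \<Longrightarrow> \<bar>h x\<bar> \<le> B"
      unfolding bounded_iff by auto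
    \<comment> \<open>The value of \<open>h\<close> at \<open>\<gamma> (\<bar>B\<bar> + 1)\<close>
      is \<open>\<bar>B\<bar> + 1\<close>, which exceeds the supposed bound
      \<open>B\<close>.\<close>
    have "0 \<le> \<bar>B\<bar> + 1" by simp
    from B[OF class_K_nonneg[OF K this]] h\<gamma>[OF this] show False by simp
  qed
  ultimately have "h \<in> class_K_inf"
    using h0 by (auto simp: class_K_inf_def class_K_def strict_mono_on_def h_nonneg h_less)
  then show thesis using that h\<gamma> \<gamma>h by blast
qed

section \<open>Distance to the cone: the uniform small-gain condition versus MBI\<close>

text \<open>The point \<open>x + b\<close> lies in the cone, at distance \<open>norm b\<close> from
  \<open>x\<close>.\<close>

lemma infdist_cone_le:
  assumes "- x \<preceq> b" and "b \<in> linf_cone"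
  shows "infdist x linf_cone \<le> norm b"
proof -
  have "x + b \<in> linf_cone"
    unfolding linf_cone_iff
  proof
    fix i
    show "0 \<le> (x + b) i"
      using assms(1)[unfolded linf_le_def, rule_format, of i] by simp
  qed
  then have "infdist x linf_cone \<le> dist x (x + b)"
    by (rule infdist_le)
  then show ?thesis by (simp add: dist_norm)
qed

text \<open>For every \<open>y\<close> in the cone,
  \<open>- x i \<le> y i - x i \<le> dist x y\<close>, so no point of the cone is closer than the
  norm of the negative part of \<open>x\<close>.\<close>

lemma norm_neg_part_le_infdist:
  "norm (0 \<oplus> - x) \<le> infdist x linf_cone"
proof -
  have "norm (0 \<oplus> - x) \<le> dist x y" if y: "y \<in> linf_cone" for y
  proof (rule norm_le_cone)
    show "0 \<oplus> - x \<in> linf_cone"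
      using zero_in_linf_cone by (rule linf_max_in_cone)
    fix i
    have "0 \<le> y i" using y by (simp add: linf_cone_iff)
    moreover have "\<bar>x i - y i\<bar> \<le> dist x y"
      using abs_apply_le_norm[of "x - y" i] by (simp add: dist_norm)
    ultimately show "(0 \<oplus> - x) i \<le> dist x y"
      by (simp add: linf_max_apply)
  qed
  moreover have "linf_cone \<noteq> {}"
    using zero_in_linf_cone by blast
  ultimately show ?thesis
    unfolding infdist_def by (auto intro: cINF_greatest)
qed

lemma uniform_SGC_imp_MBI:
  assumes "uniform_SGC \<Gamma>"
  shows "MBI \<Gamma>"
proof -
  obtain \<eta> where \<eta>: "\<eta> \<in> class_K_inf"
    and le: "\<And>s. s \<in> linf_cone \<Longrightarrow> \<eta> (norm s) \<le> infdist (\<Gamma> s - s) linf_cone"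
    using assms unfolding uniform_SGC_def by blast
  obtain \<xi> where \<xi>: "\<xi> \<in> class_K_inf" and inv: "\<And>r. 0 \<le> r \<Longrightarrow> \<xi> (\<eta> r) = r"
    using class_K_inf_inverse[OF \<eta>] by metis
  have "norm s \<le> \<xi> (norm b)"
    if "s \<in> linf_cone" "b \<in> linf_cone" "s - \<Gamma> s \<preceq> b" for s b
  proof -
    have "\<eta> (norm s) \<le> norm b"
      using le[OF that(1)] infdist_cone_le[of "\<Gamma> s - s" b] that by simp
    then have "\<xi> (\<eta> (norm s)) \<le> \<xi> (norm b)"
      using class_K_nonneg[OF class_K_inf_class_K[OF \<eta>]]
      by (intro class_K_mono[OF class_K_inf_class_K[OF \<xi>]]) auto
    then show ?thesis by (simp add: inv)
  qed
  then show ?thesis using \<xi> unfolding MBI_def by blast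
qed

lemma MBI_imp_uniform_SGC:
  assumes "MBI \<Gamma>"
  shows "uniform_SGC \<Gamma>"
proof -
  obtain \<xi> where \<xi>: "\<xi> \<in> class_K_inf"
    and le: "\<And>s b. s \<in> linf_cone \<Longrightarrow> b \<in> linf_cone \<Longrightarrow> s - \<Gamma> s \<preceq> b \<Longrightarrow> norm s \<le> \<xi> (norm b)"
    using assms unfolding MBI_def by blast
  obtain \<eta> where \<eta>: "\<eta> \<in> class_K_inf" and inv: "\<And>r. 0 \<le> r \<Longrightarrow> \<eta> (\<xi> r) = r"
    using class_K_inf_inverse[OF \<xi>] by metis
  have "\<eta> (norm s) \<le> infdist (\<Gamma> s - s) linf_cone" if "s \<in> linf_cone" for s
  proof -
    \<comment> \<open>The positive part of \<open>s - \<Gamma> s\<close> is the least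
      \<open>b\<close> in the cone with \<open>s - \<Gamma> s \<preceq> b\<close>, so it gives the
      sharpest instance of MBI.\<close>
    let ?b = "0 \<oplus> - (\<Gamma> s - s)"
    have "norm s \<le> \<xi> (norm ?b)"
      using that zero_in_linf_cone
      by (intro le linf_max_in_cone) (auto simp: linf_le_def linf_max_apply)
    then have "\<eta> (norm s) \<le> \<eta> (\<xi> (norm ?b))"
      by (intro class_K_mono[OF class_K_inf_class_K[OF \<eta>]]) auto
    also have "\<dots> = norm ?b" by (simp add: inv)
    also have "\<dots> \<le> infdist (\<Gamma> s - s) linf_cone" by (rule norm_neg_part_le_infdist)
    finally show ?thesis .
  qed
  then show ?thesis using \<eta> unfolding uniform_SGC_def by blast
qed

text \<open>If \<open>s \<preceq> \<Gamma> s\<close>, the property applies with \<open>b = 0\<close>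
  and yields \<open>norm s \<le> \<phi> 0 = 0\<close>.\<close>

lemma max_MBI_imp_SGC:
  assumes "max_MBI \<Gamma>"
  shows "SGC \<Gamma>"
proof -
  obtain \<phi> where \<phi>: "\<phi> \<in> class_K_inf"
    and le: "\<And>s b. s \<in> linf_cone \<Longrightarrow> b \<in> linf_cone \<Longrightarrow> s \<preceq> \<Gamma> s \<oplus> b \<Longrightarrow> norm s \<le> \<phi> (norm b)"
    using assms unfolding max_MBI_def by blast
  have "s = 0" if "s \<in> linf_cone" "s \<preceq> \<Gamma> s" for s
  proof -
    have "s \<preceq> \<Gamma> s \<oplus> 0"
      using that(2) by (auto simp: linf_le_def linf_max_apply le_max_iff_disj)
    with le[OF that(1) zero_in_linf_cone] show ?thesis
      using class_K_zero[OF class_K_inf_class_K[OF \<phi>]] by simp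
  qed
  then show ?thesis unfolding SGC_def by blast
qed

lemma SGC_imp_no_nonzero_fixed_points: "SGC \<Gamma> \<Longrightarrow> no_nonzero_fixed_points \<Gamma>"
  unfolding SGC_def no_nonzero_fixed_points_def by (metis linf_le_refl)

section \<open>Componentwise limits\<close>

text \<open>The common bound \<open>B\<close> passes to the limit, which makes the componentwise
  limit a bounded sequence and hence an element of the space.\<close>

lemma pointwise_limit_in_cone:
  fixes x :: "nat \<Rightarrow> linf"
  assumes cone: "\<And>k. x k \<in> linf_cone" and bound: "\<And>k. norm (x k) \<le> B"
    and conv: "\<And>i. convergent (\<lambda>k. x k i)"
  obtains l where "l \<in> linf_cone" and "\<And>i. (\<lambda>k. x k i) \<longlonglongrightarrow> l i"
proof -
  define f where "f i = lim (\<lambda>k. x k i)" for i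
  have lim: "(\<lambda>k. x k i) \<longlonglongrightarrow> f i" for i
    using conv[of i] by (simp add: f_def convergent_LIMSEQ_iff)
  have "0 \<le> f i" for i
    using cone by (intro LIMSEQ_le_const[OF lim]) (auto simp: linf_cone_iff)
  moreover have "f i \<le> B" for i
    using bound by (intro LIMSEQ_le_const2[OF lim]) (meson apply_le_norm order_trans)
  ultimately have "apply_bcontfun (Bcontfun f) = f"
    by (intro apply_Bcontfun_abs_le[where B = B]) (simp add: abs_le_iff order_trans)
  then show thesis
    using that[of "Bcontfun f"] lim \<open>\<And>i. 0 \<le> f i\<close> by (simp add: linf_cone_iff)
qed

text \<open>All differences live on the finite set \<open>J\<close>, so the sup norm is dominated by
  a finite sum of coordinate errors, each tending to zero.\<close>

lemma tendsto_finite_support: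
  fixes x :: "nat \<Rightarrow> linf" and l :: linf
  assumes J: "finite J" and supp: "\<And>k j. j \<notin> J \<Longrightarrow> x k j = l j"
    and lim: "\<And>j. j \<in> J \<Longrightarrow> (\<lambda>k. x k j) \<longlonglongrightarrow> l j"
  shows "x \<longlonglongrightarrow> l"
proof (rule metric_tendsto_imp_tendsto)
  show "(\<lambda>k. \<Sum>j\<in>J. \<bar>x k j - l j\<bar>) \<longlonglongrightarrow> 0"
    using lim by (intro tendsto_null_sum tendsto_rabs_zero LIM_zero)
  have "norm (x k - l) \<le> (\<Sum>j\<in>J. \<bar>x k j - l j\<bar>)" for k
  proof (rule norm_bound)
    fix j
    show "norm ((x k - l) j) \<le> (\<Sum>j\<in>J. \<bar>x k j - l j\<bar>)"
    proof (cases "j \<in> J")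
      case True
      then show ?thesis
        using member_le_sum[of j J "\<lambda>j. \<bar>x k j - l j\<bar>"] J by simp
    next
      case False
      then show ?thesis by (simp add: supp sum_nonneg)
    qed
  qed
  then show "\<forall>\<^sub>F k in sequentially. dist (x k) l \<le> dist (\<Sum>j\<in>J. \<bar>x k j - l j\<bar>) 0"
    by (intro always_eventually) (simp add: dist_norm sum_nonneg)
qed

section \<open>Monotonicity and componentwise continuity of gain operators\<close>

context
  fixes I \<gamma> \<mu> \<Gamma>
  assumes gain: "is_gain_operator I \<gamma> \<mu> \<Gamma>"
begin

lemma gain_unfold:
  shows "\<forall>i. finite (I i) \<and> i \<notin> I i"
    and "\<forall>i j. \<gamma> i j \<in> class_K \<or> (\<forall>r\<ge>0. \<gamma> i j r = 0)"
    and "\<forall>i j. j \<notin> I i \<longrightarrow> (\<forall>r\<ge>0. \<gamma> i j r = 0)"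
    and "\<forall>i. MAF (\<mu> i)"
    and "\<Gamma> ` linf_cone \<subseteq> linf_cone"
    and "\<forall>s\<in>linf_cone. \<forall>i. ennreal (\<Gamma> s i) = \<mu> i (Bcontfun (\<lambda>j. \<gamma> i j (s j)))"
    and gain_continuous: "continuous_on linf_cone \<Gamma>"
  using gain unfolding is_gain_operator_def by - (elim conjE, assumption)+

lemma gain_in_cone: "s \<in> linf_cone \<Longrightarrow> \<Gamma> s \<in> linf_cone"
  using gain_unfold(5) by (rule subsetD[OF _ imageI])

lemma finite_inputs: "finite (I i)"
  using gain_unfold(1) by simp

lemma ennreal_gain_apply:
  "s \<in> linf_cone \<Longrightarrow> ennreal (\<Gamma> s i) = \<mu> i (Bcontfun (\<lambda>j. \<gamma> i j (s j)))"
  using gain_unfold(6) by simp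

lemma gain_apply:
  assumes "s \<in> linf_cone"
  shows "\<Gamma> s i = enn2real (\<mu> i (Bcontfun (\<lambda>j. \<gamma> i j (s j))))"
proof -
  have "ennreal (\<Gamma> s i) = \<mu> i (Bcontfun (\<lambda>j. \<gamma> i j (s j)))"
    using assms by (rule ennreal_gain_apply)
  moreover have "0 \<le> \<Gamma> s i"
    using gain_in_cone[OF assms] by (simp add: linf_cone_iff)
  ultimately show ?thesis by (metis enn2real_ennreal)
qed

lemma gain_weights_zero:
  assumes "s \<in> linf_cone" and "j \<notin> I i"
  shows "\<gamma> i j (s j) = 0"
  using gain_unfold(3) assms by (simp add: linf_cone_iff)

lemma apply_gain_weights:
  assumes "s \<in> linf_cone"
  shows "apply_bcontfun (Bcontfun (\<lambda>j. \<gamma> i j (s j))) = (\<lambda>j. \<gamma> i j (s j))"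
proof (rule apply_Bcontfun_finite_support)
  have "{j. \<gamma> i j (s j) \<noteq> 0} \<subseteq> I i"
    using gain_weights_zero[OF assms] by blast
  then show "finite {j. \<gamma> i j (s j) \<noteq> 0}"
    using finite_inputs by (rule finite_subset)
qed

lemma gain_weight_mono:
  assumes "0 \<le> r" and "r \<le> t"
  shows "0 \<le> \<gamma> i j r" and "\<gamma> i j r \<le> \<gamma> i j t"
proof -
  have "\<gamma> i j \<in> class_K \<or> (\<forall>r\<ge>0. \<gamma> i j r = 0)"
    using gain_unfold(2) by simp
  then show "0 \<le> \<gamma> i j r" "\<gamma> i j r \<le> \<gamma> i j t"
    using assms class_K_nonneg[of "\<gamma> i j" r] class_K_mono[of "\<gamma> i j" r t] by auto
qed

lemma gain_mono:
  assumes s: "s \<in> linf_cone" and t: "t \<in> linf_cone" and "s \<preceq> t"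
  shows "\<Gamma> s \<preceq> \<Gamma> t"
  unfolding linf_le_def
proof
  fix i
  let ?w = "\<lambda>s :: linf. Bcontfun (\<lambda>j. \<gamma> i j (s j))"
  have nonneg: "0 \<le> s j" "0 \<le> t j" "s j \<le> t j" for j
    using assms by (auto simp: linf_cone_iff linf_le_def)
  have "?w s \<in> linf_cone" "?w t \<in> linf_cone" "?w s \<preceq> ?w t"
    using nonneg
    by (auto simp: linf_cone_iff linf_le_def apply_gain_weights[OF s] apply_gain_weights[OF t]
        intro: gain_weight_mono(1)[OF _ order_refl] gain_weight_mono(2))
  moreover have "MAF (\<mu> i)"
    using gain_unfold(4) by simp
  ultimately have "\<mu> i (?w s) \<le> \<mu> i (?w t)"
    unfolding MAF_def by blast
  then have "ennreal (\<Gamma> s i) \<le> ennreal (\<Gamma> t i)"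
    by (simp only: ennreal_gain_apply s t)
  then show "\<Gamma> s i \<le> \<Gamma> t i"
    using gain_in_cone[OF t] by (simp add: linf_cone_iff)
qed

text \<open>Coordinates outside \<open>I i\<close> enter component \<open>i\<close> with weight
  zero.\<close>

lemma gain_cong:
  assumes "s \<in> linf_cone" and "t \<in> linf_cone" and "\<And>j. j \<in> I i \<Longrightarrow> s j = t j"
  shows "\<Gamma> s i = \<Gamma> t i"
proof -
  have "\<gamma> i j (s j) = \<gamma> i j (t j)" for j
    using assms gain_weights_zero[of _ j i] by (cases "j \<in> I i") auto
  then show ?thesis by (simp add: gain_apply assms)
qed

text \<open>Truncating to the coordinates in \<open>I i\<close> leaves component \<open>i\<close> of
  \<open>\<Gamma>\<close> unchanged and turns componentwise convergence into norm convergence. Norm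
  continuity of \<open>\<Gamma>\<close> then applies to the truncated sequences.\<close>

lemma gain_tendsto:
  fixes x :: "nat \<Rightarrow> linf"
  assumes x: "\<And>k. x k \<in> linf_cone" and l: "l \<in> linf_cone"
    and lim: "\<And>i. (\<lambda>k. x k i) \<longlonglongrightarrow> l i"
  shows "(\<lambda>k. \<Gamma> (x k) i) \<longlonglongrightarrow> \<Gamma> l i"
proof -
  define c where "c s = Bcontfun (\<lambda>j. if j \<in> I i then s j else 0)" for s :: linf
  have c: "apply_bcontfun (c s) = (\<lambda>j. if j \<in> I i then s j else 0)" for s
    unfolding c_def by (rule apply_Bcontfun_finite_support) (simp add: finite_inputs)
  have c_cone: "c s \<in> linf_cone" if "s \<in> linf_cone" for s
    using that by (simp add: linf_cone_iff c)
  have eq: "\<Gamma> (c s) i = \<Gamma> s i" if "s \<in> linf_cone" for s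
    using that by (intro gain_cong c_cone) (simp_all add: c)
  have "(\<lambda>k. c (x k)) \<longlonglongrightarrow> c l"
    using lim by (intro tendsto_finite_support[OF finite_inputs[of i]]) (simp_all add: c)
  then have "(\<lambda>k. \<Gamma> (c (x k))) \<longlonglongrightarrow> \<Gamma> (c l)"
    using c_cone x l by (intro continuous_on_tendsto_compose[OF gain_continuous]) auto
  then have "(\<lambda>k. \<Gamma> (c (x k)) i) \<longlonglongrightarrow> \<Gamma> (c l) i"
    by (rule continuous_on_tendsto_compose[OF continuous_on_linf_apply[of UNIV]]) auto
  then show ?thesis by (simp add: eq x l)
qed

section \<open>Orbits of the gain operator and of its augmentation\<close>

lemma gain_iterate_in_cone: "s \<in> linf_cone \<Longrightarrow> (\<Gamma> ^^ k) s \<in> linf_cone"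
  by (induction k) (auto intro: gain_in_cone)

lemma gain_iterate_mono:
  assumes "s \<in> linf_cone" "t \<in> linf_cone" "s \<preceq> t"
  shows "(\<Gamma> ^^ k) s \<preceq> (\<Gamma> ^^ k) t"
  using assms by (induction k) (auto intro: gain_mono gain_iterate_in_cone)

lemma augmented_iterate_in_cone: "s \<in> linf_cone \<Longrightarrow> (augmented \<Gamma> ^^ k) s \<in> linf_cone"
  by (induction k) (auto simp: augmented_def intro: linf_max_in_cone)

lemma augmented_iterate_Suc_ge: "(augmented \<Gamma> ^^ k) s \<preceq> (augmented \<Gamma> ^^ Suc k) s"
  by (simp add: augmented_def linf_le_def linf_max_apply)

text \<open>This puts every iterate in the form required by the \<open>\<oplus>\<close>-MBI
  property, with the initial state \<open>s\<close> as the fixed input \<open>b\<close>.\<close>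

lemma augmented_iterate_le:
  assumes s: "s \<in> linf_cone"
  shows "(augmented \<Gamma> ^^ k) s \<preceq> \<Gamma> ((augmented \<Gamma> ^^ k) s) \<oplus> s"
proof (induction k)
  case 0
  then show ?case by (simp add: linf_le_def linf_max_apply)
next
  case (Suc k)
  let ?x = "(augmented \<Gamma> ^^ k) s" and ?y = "(augmented \<Gamma> ^^ Suc k) s"
  have mono: "\<Gamma> ?x \<preceq> \<Gamma> ?y"
    using s by (intro gain_mono augmented_iterate_in_cone augmented_iterate_Suc_ge)
  show ?case
    unfolding linf_le_def
  proof
    fix i
    \<comment> \<open>If the maximum is \<open>?x i\<close>, the induction hypothesis bounds it by
      \<open>max (\<Gamma> ?x i) (s i)\<close>. In either case monotonicity replaces
      \<open>\<Gamma> ?x i\<close> by \<open>\<Gamma> ?y i\<close>.\<close>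
    have "?y i = max (?x i) (\<Gamma> ?x i)"
      by (simp add: augmented_def linf_max_apply)
    moreover have "?x i \<le> max (\<Gamma> ?x i) (s i)"
      using Suc unfolding linf_le_def linf_max_apply by blast
    moreover have "\<Gamma> ?x i \<le> \<Gamma> ?y i"
      using mono unfolding linf_le_def by blast
    ultimately show "?y i \<le> (\<Gamma> ?y \<oplus> s) i"
      unfolding linf_max_apply by linarith
  qed
qed

section \<open>Implications between the stability conditions\<close>

text \<open>The maximum of two nonnegative numbers is at most their sum, so the same comparison
  function serves.\<close>

lemma MBI_imp_max_MBI:
  assumes "MBI \<Gamma>"
  shows "max_MBI \<Gamma>"
proof -
  have "s - \<Gamma> s \<preceq> b" if s: "s \<in> linf_cone" "b \<in> linf_cone" "s \<preceq> \<Gamma> s \<oplus> b" for s b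
    unfolding linf_le_def
  proof
    fix i
    have "s i \<le> max (\<Gamma> s i) (b i)" "0 \<le> b i" "0 \<le> \<Gamma> s i"
      using s gain_in_cone[of s] by (auto simp: linf_le_def linf_max_apply linf_cone_iff)
    then show "(s - \<Gamma> s) i \<le> b i" by simp
  qed
  then show ?thesis
    using assms unfolding MBI_def max_MBI_def by blast
qed

lemma max_MBI_imp_UGS:
  assumes "max_MBI \<Gamma>"
  shows "UGS (augmented \<Gamma>)"
  using assms augmented_iterate_le augmented_iterate_in_cone
  unfolding max_MBI_def UGS_def by blast

text \<open>If \<open>s \<preceq> \<Gamma> s\<close>, monotonicity keeps the whole orbit above
  \<open>s\<close>; since its components tend to zero, \<open>s\<close> must vanish.\<close>

lemma attractive_imp_SGC:
  assumes "componentwise_attractive \<Gamma>"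
  shows "SGC \<Gamma>"
proof -
  have "s = 0" if s: "s \<in> linf_cone" "s \<preceq> \<Gamma> s" for s
  proof (rule bcontfun_eqI)
    fix i
    have ge: "s \<preceq> (\<Gamma> ^^ k) s" for k
    proof (induction k)
      case (Suc k)
      then show ?case
        using s gain_mono[OF _ gain_iterate_in_cone] by (auto intro: linf_le_trans)
    qed (simp add: linf_le_refl)
    have "(\<lambda>k. (\<Gamma> ^^ k) s i) \<longlonglongrightarrow> 0"
      using assms s unfolding componentwise_attractive_def by blast
    then have "s i \<le> 0"
      using ge by (intro LIMSEQ_le_const) (auto simp: linf_le_def)
    then show "s i = (0 :: linf) i"
      using s by (simp add: linf_cone_iff antisym)
  qed
  then show ?thesis unfolding SGC_def by blast
qed

text \<open>The witness is the componentwise limit of the augmented orbit, which is increasing by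
  construction and bounded by UGS.\<close>

lemma UGS_imp_decay_point_above:
  assumes "UGS (augmented \<Gamma>)" and s: "s \<in> linf_cone"
  obtains t where "t \<in> linf_cone" and "s \<preceq> t" and "\<Gamma> t \<preceq> t"
proof -
  define x where "x k = (augmented \<Gamma> ^^ k) s" for k
  obtain \<phi> where \<phi>: "\<And>k. norm (x k) \<le> \<phi> (norm s)"
    using assms unfolding UGS_def x_def by blast
  have x: "x k \<in> linf_cone" for k
    unfolding x_def using s by (rule augmented_iterate_in_cone)
  have inc: "incseq (\<lambda>k. x k i)" for i
    using augmented_iterate_Suc_ge unfolding x_def linf_le_def by (intro incseq_SucI) blast
  have "convergent (\<lambda>k. x k i)" for i
  proof -
    have "x k i \<le> \<phi> (norm s)" for k
      using \<phi> apply_le_norm order_trans by blast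
    then show ?thesis
      using incseq_convergent[OF inc[of i], of "\<phi> (norm s)"] unfolding convergent_def by metis
  qed
  then obtain t where t: "t \<in> linf_cone" and lim: "\<And>i. (\<lambda>k. x k i) \<longlonglongrightarrow> t i"
    by (rule pointwise_limit_in_cone[OF x \<phi>]) blast
  have "s i \<le> t i" for i
    using incseq_le[OF inc lim, of 0 i] by (simp add: x_def)
  \<comment> \<open>The inequality between \<open>\<Gamma> (x k)\<close> and
    \<open>x (Suc k)\<close> survives the limit because both sides converge componentwise.\<close>
  moreover have "\<Gamma> t i \<le> t i" for i
  proof (rule LIMSEQ_le)
    show "(\<lambda>k. \<Gamma> (x k) i) \<longlonglongrightarrow> \<Gamma> t i"
      using x t lim by (rule gain_tendsto)
    show "(\<lambda>k. x (Suc k) i) \<longlonglongrightarrow> t i"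
      by (rule LIMSEQ_Suc[OF lim])
    show "\<exists>N. \<forall>k\<ge>N. \<Gamma> (x k) i \<le> x (Suc k) i"
      by (simp add: x_def augmented_def linf_max_apply)
  qed
  ultimately show thesis using that t by (simp add: linf_le_def)
qed

text \<open>From a point with \<open>\<Gamma> t \<preceq> t\<close> the orbit decreases;
  componentwise continuity makes its limit a fixed point, hence zero.\<close>

lemma no_fixed_points_imp_decay:
  assumes fp: "no_nonzero_fixed_points \<Gamma>" and t: "t \<in> linf_cone" and "\<Gamma> t \<preceq> t"
  shows "(\<lambda>k. (\<Gamma> ^^ k) t i) \<longlonglongrightarrow> 0"
proof -
  define x where "x k = (\<Gamma> ^^ k) t" for k
  have x: "x k \<in> linf_cone" for k
    unfolding x_def using t by (rule gain_iterate_in_cone)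
  have "x (Suc k) \<preceq> x k" for k
    using gain_iterate_mono[OF gain_in_cone[OF t] t \<open>\<Gamma> t \<preceq> t\<close>, of k]
    by (simp add: x_def funpow_swap1)
  then have dec: "decseq (\<lambda>k. x k i)" for i
    by (intro decseq_SucI) (simp add: linf_le_def)
  have "norm (x k) \<le> norm t" for k
  proof (rule norm_le_cone[OF x])
    fix i
    have "x k i \<le> x 0 i"
      using dec[of i] by (simp add: decseq_def)
    then show "x k i \<le> norm t"
      using apply_le_norm[of t i] by (simp add: x_def)
  qed
  moreover have "convergent (\<lambda>k. x k i)" for i
  proof -
    have "0 \<le> x k i" for k using x by (simp add: linf_cone_iff)
    then show ?thesis
      using decseq_convergent[OF dec[of i], of 0] unfolding convergent_def by metis
  qed
  ultimately obtain l where l: "l \<in> linf_cone" and lim: "\<And>i. (\<lambda>k. x k i) \<longlonglongrightarrow> l i"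
    by (rule pointwise_limit_in_cone[OF x]) blast
  have "\<Gamma> l = l"
  proof (rule bcontfun_eqI)
    fix i
    have "(\<lambda>k. x (Suc k) i) \<longlonglongrightarrow> \<Gamma> l i"
      using gain_tendsto[OF x l lim] by (simp add: x_def)
    then show "\<Gamma> l i = l i"
      using LIMSEQ_Suc[OF lim] LIMSEQ_unique by blast
  qed
  then have "l = 0"
    using fp l unfolding no_nonzero_fixed_points_def by blast
  then show ?thesis
    using lim[of i] by (simp add: x_def)
qed

text \<open>The orbit of \<open>s\<close> is squeezed between zero and the decaying orbit of a point
  \<open>t\<close> above \<open>s\<close>.\<close>

lemma UGS_no_fixed_points_imp_attractive:
  assumes "UGS (augmented \<Gamma>)" and "no_nonzero_fixed_points \<Gamma>"
  shows "componentwise_attractive \<Gamma>"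
  unfolding componentwise_attractive_def
proof (intro ballI allI)
  fix s i
  assume s: "s \<in> linf_cone"
  obtain t where t: "t \<in> linf_cone" "s \<preceq> t" "\<Gamma> t \<preceq> t"
    using UGS_imp_decay_point_above[OF assms(1) s] by blast
  have "0 \<le> (\<Gamma> ^^ k) s i" "(\<Gamma> ^^ k) s i \<le> (\<Gamma> ^^ k) t i" for k
    using gain_iterate_in_cone[OF s] gain_iterate_mono[OF s t(1,2)]
    by (auto simp: linf_cone_iff linf_le_def)
  then show "(\<lambda>k. (\<Gamma> ^^ k) s i) \<longlonglongrightarrow> 0"
    by (intro tendsto_sandwich[OF _ _ tendsto_const
          no_fixed_points_imp_decay[OF assms(2) t(1,3)]] always_eventually) auto
qed

end

section \<open>A gain operator with the \<open>\<oplus>\<close>-MBI property but without MBI\<close>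

definition quad_gain :: "real \<Rightarrow> real"
  where "quad_gain r = r\<^sup>2 / (1 + r)"

text \<open>This form isolates the margin \<open>r / (1 + r)\<close>: it is positive for
  \<open>r > 0\<close>, which gives \<open>\<oplus>\<close>-MBI, but stays below 1, which defeats
  MBI.\<close>

lemma quad_gain_eq: "0 \<le> r \<Longrightarrow> quad_gain r = r - r / (1 + r)"
  by (simp add: quad_gain_def field_simps power2_eq_square)

lemma quad_gain_nonneg: "0 \<le> r \<Longrightarrow> 0 \<le> quad_gain r"
  by (simp add: quad_gain_def)

text \<open>The factor next to \<open>t - r\<close> lies in [0, 1) and is zero only for
  \<open>r = t = 0\<close>; this yields both strict monotonicity and the Lipschitz constant
  1.\<close>

lemma quad_gain_diff:
  assumes "0 \<le> r" "0 \<le> t"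
  shows "quad_gain t - quad_gain r = (t - r) * (1 - 1 / ((1 + r) * (1 + t)))"
proof -
  have "1 + r \<noteq> 0" "1 + t \<noteq> 0" using assms by auto
  then show ?thesis
    unfolding quad_gain_def by (simp add: divide_simps) (simp add: algebra_simps power2_eq_square)
qed

lemma quad_gain_class_K: "quad_gain \<in> class_K"
proof -
  have "quad_gain r < quad_gain t" if "0 \<le> r" "r < t" for r t
  proof -
    have "1 + r > 0" "1 + t > 1" using that by auto
    moreover have "1 < (1 + r) * (1 + t)"
      using that mult_le_less_imp_less[of 1 "1 + r" 1 "1 + t"] by simp
    ultimately have "0 < quad_gain t - quad_gain r"
      using that by (subst quad_gain_diff) auto
    then show ?thesis by simp
  qed
  moreover have "continuous_on {0..} quad_gain"
    unfolding quad_gain_def by (intro continuous_intros) auto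
  moreover have "quad_gain 0 = 0" by (simp add: quad_gain_def)
  ultimately show ?thesis
    by (auto simp: class_K_def strict_mono_on_def quad_gain_nonneg)
qed

lemma quad_gain_Lipschitz:
  assumes "0 \<le> r" "0 \<le> t"
  shows "\<bar>quad_gain t - quad_gain r\<bar> \<le> \<bar>t - r\<bar>"
proof -
  have "1 \<le> (1 + r) * (1 + t)"
    using assms by (simp add: algebra_simps)
  then have "\<bar>1 - 1 / ((1 + r) * (1 + t))\<bar> \<le> 1"
    by (simp add: divide_simps)
  then show ?thesis
    using assms by (simp add: quad_gain_diff abs_mult mult_left_le)
qed

lemma quad_gain_le_self: "0 \<le> r \<Longrightarrow> quad_gain r \<le> r"
  by (simp add: quad_gain_eq)

definition quad_shift :: "linf \<Rightarrow> linf"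
  where "quad_shift s = Bcontfun (\<lambda>i. quad_gain (s (Suc i)))"

lemma quad_shift_apply:
  assumes "s \<in> linf_cone"
  shows "quad_shift s i = quad_gain (s (Suc i))"
proof -
  have "\<bar>quad_gain (s (Suc i))\<bar> \<le> norm s" for i
  proof -
    have "0 \<le> s (Suc i)" using assms by (simp add: linf_cone_iff)
    then show ?thesis
      using quad_gain_nonneg quad_gain_le_self apply_le_norm[of s "Suc i"] by fastforce
  qed
  then show ?thesis
    unfolding quad_shift_def by (subst apply_Bcontfun_abs_le) auto
qed

text \<open>Component \<open>i\<close> has the single input \<open>Suc i\<close>, and its
  aggregation function just reads off that coordinate. Norm continuity holds because the shift is
  nonexpansive on the cone.\<close>

lemma quad_shift_gain_operator:
  "is_gain_operator (\<lambda>i. {Suc i}) (\<lambda>i j. if j = Suc i then quad_gain else (\<lambda>_. 0))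
     (\<lambda>i s. ennreal (s (Suc i))) quad_shift"
  unfolding is_gain_operator_def
proof (intro conjI allI ballI)
  fix i j
  let ?\<gamma> = "if j = Suc i then quad_gain else (\<lambda>_. 0)"
  show "finite {Suc i}" "i \<notin> {Suc i}" by auto
  show "?\<gamma> \<in> class_K \<or> (\<forall>r\<ge>0. ?\<gamma> r = 0)"
    using quad_gain_class_K by simp
  show "j \<notin> {Suc i} \<longrightarrow> (\<forall>r\<ge>0. ?\<gamma> r = 0)" by simp
  show "MAF (\<lambda>s. ennreal (s (Suc i)))"
    unfolding MAF_def
    by (auto simp: linf_le_def intro!: ennreal_leI continuous_on_ennreal continuous_on_linf_apply)
next
  show "quad_shift ` linf_cone \<subseteq> linf_cone"
    unfolding image_subset_iff
  proof
    fix s assume "s \<in> linf_cone"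
    then show "quad_shift s \<in> linf_cone"
      by (simp add: linf_cone_iff[of "quad_shift s"] quad_shift_apply)
         (simp add: linf_cone_iff quad_gain_nonneg)
  qed
next
  fix s i
  assume s: "s \<in> linf_cone"
  let ?w = "\<lambda>j. (if j = Suc i then quad_gain else (\<lambda>_. 0)) (s j)"
  have "{j. ?w j \<noteq> 0} \<subseteq> {Suc i}" by auto
  then have "finite {j. ?w j \<noteq> 0}" by (rule finite_subset) simp
  then have "apply_bcontfun (Bcontfun ?w) = ?w"
    by (rule apply_Bcontfun_finite_support)
  then show "ennreal (quad_shift s i) = ennreal (Bcontfun ?w (Suc i))"
    by (simp add: quad_shift_apply s)
next
  show "continuous_on linf_cone quad_shift"
    unfolding continuous_on_iff
  proof (intro ballI allI impI)
    fix s and e :: real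
    assume s: "s \<in> linf_cone" and e: "0 < e"
    have "dist (quad_shift t) (quad_shift s) \<le> dist t s" if t: "t \<in> linf_cone" for t
    proof (rule dist_bound)
      fix i
      have "0 \<le> s (Suc i)" "0 \<le> t (Suc i)" using s t by (auto simp: linf_cone_iff)
      then have "dist (quad_shift t i) (quad_shift s i) \<le> dist (t (Suc i)) (s (Suc i))"
        by (simp add: quad_shift_apply s t dist_real_def quad_gain_Lipschitz)
      also have "\<dots> \<le> dist t s" by (rule dist_bounded)
      finally show "dist (quad_shift t i) (quad_shift s i) \<le> dist t s" .
    qed
    then show "\<exists>d>0. \<forall>t\<in>linf_cone. dist t s < d \<longrightarrow> dist (quad_shift t) (quad_shift s) < e"
      using e by (intro exI[of _ e]) (auto intro: le_less_trans)
  qed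
qed

text \<open>The identity serves as \<open>\<phi>\<close>. Taking suprema gives
  \<open>norm s \<le> max (quad_gain (norm s)) (norm b)\<close>, and \<open>quad_gain r < r\<close>
  for \<open>r > 0\<close> excludes the first alternative when \<open>norm s\<close> exceeds
  \<open>norm b\<close>.\<close>

lemma quad_shift_max_MBI: "max_MBI quad_shift"
proof -
  have id: "(\<lambda>r. r) \<in> class_K_inf"
  proof -
    have "\<not> bounded {0 :: real..}"
    proof
      assume "bounded {0 :: real..}"
      then obtain B where "\<And>x :: real. 0 \<le> x \<Longrightarrow> \<bar>x\<bar> \<le> B"
        unfolding bounded_iff by auto
      from this[of "\<bar>B\<bar> + 1"] show False by simp
    qed
    then show ?thesis
      by (auto simp: class_K_inf_def class_K_def strict_mono_on_def)
  qed
  have "norm s \<le> norm b"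
    if s: "s \<in> linf_cone" and b: "b \<in> linf_cone" and le: "s \<preceq> quad_shift s \<oplus> b" for s b
  proof (rule ccontr)
    assume less: "\<not> norm s \<le> norm b"
    then have pos: "0 < norm s"
      using norm_ge_zero[of b] by linarith
    have "norm s \<le> max (quad_gain (norm s)) (norm b)"
    proof (rule norm_le_cone[OF s])
      fix i
      have "quad_gain (s (Suc i)) \<le> quad_gain (norm s)"
        using s by (intro class_K_mono[OF quad_gain_class_K] apply_le_norm) (simp add: linf_cone_iff)
      moreover have "s i \<le> max (quad_gain (s (Suc i))) (b i)"
        using le[unfolded linf_le_def, rule_format, of i] by (simp add: linf_max_apply quad_shift_apply s)
      ultimately show "s i \<le> max (quad_gain (norm s)) (norm b)"
        using apply_le_norm[of b i] by linarith
    qed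
    moreover have "quad_gain (norm s) < norm s"
      using pos by (simp add: quad_gain_eq add_pos_pos)
    ultimately show False using less by linarith
  qed
  then show ?thesis
    unfolding max_MBI_def by (intro bexI[OF _ id] ballI impI)
qed

text \<open>For the constant sequence \<open>c r\<close>, the difference
  \<open>c r - quad_shift (c r)\<close> has all components \<open>r / (1 + r) \<le> 1\<close>. The
  single input \<open>c 1\<close> thus admits states of arbitrarily large norm.\<close>

lemma quad_shift_not_MBI: "\<not> MBI quad_shift"
proof
  assume "MBI quad_shift"
  then obtain \<xi> where
    le: "\<And>s b. s \<in> linf_cone \<Longrightarrow> b \<in> linf_cone \<Longrightarrow> s - quad_shift s \<preceq> b \<Longrightarrow> norm s \<le> \<xi> (norm b)"
    unfolding MBI_def by blast
  define c :: "real \<Rightarrow> linf" where "c = const_bcontfun"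
  have c: "c r i = r" for r and i :: nat
    by (simp add: c_def const_bcontfun.rep_eq)
  have cone: "c r \<in> linf_cone" if "0 \<le> r" for r
    using that by (simp add: linf_cone_iff c)
  have "r \<le> \<xi> (norm (c 1))" if r: "0 \<le> r" for r
  proof -
    have "(c r - quad_shift (c r)) i \<le> c 1 i" for i
      using r by (simp add: quad_shift_apply cone c quad_gain_eq)
    then have "norm (c r) \<le> \<xi> (norm (c 1))"
      using r by (intro le cone) (auto simp: linf_le_def)
    then show ?thesis
      using apply_le_norm[of "c r" 0] by (simp add: c)
  qed
  \<comment> \<open>This choice of \<open>r\<close> exceeds the bound
    \<open>\<xi> (norm (c 1))\<close>, which does not depend on \<open>r\<close>.\<close>
  from this[of "\<bar>\<xi> (norm (c 1))\<bar> + 1"] show False by simp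
qed

theorem proposition3p11:
  shows "(\<forall>I \<gamma> \<mu> \<Gamma>. is_gain_operator I \<gamma> \<mu> \<Gamma> \<longrightarrow>
      (uniform_SGC \<Gamma> \<longleftrightarrow> MBI \<Gamma>) \<and>
      (MBI \<Gamma> \<longrightarrow> max_MBI \<Gamma>) \<and>
      (max_MBI \<Gamma> \<longrightarrow> UGS (augmented \<Gamma>) \<and> componentwise_attractive \<Gamma>) \<and>
      (UGS (augmented \<Gamma>) \<and> componentwise_attractive \<Gamma> \<longleftrightarrow> UGS (augmented \<Gamma>) \<and> SGC \<Gamma>) \<and>
      (UGS (augmented \<Gamma>) \<and> SGC \<Gamma> \<longleftrightarrow> UGS (augmented \<Gamma>) \<and> no_nonzero_fixed_points \<Gamma>))
    \<and> (\<exists>I \<gamma> \<mu> \<Gamma>. is_gain_operator I \<gamma> \<mu> \<Gamma> \<and> max_MBI \<Gamma> \<and> \<not> MBI \<Gamma>)"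
proof (intro conjI allI impI)
  fix I \<gamma> \<mu> \<Gamma>
  assume gain: "is_gain_operator I \<gamma> \<mu> \<Gamma>"
  show "uniform_SGC \<Gamma> \<longleftrightarrow> MBI \<Gamma>"
    using uniform_SGC_imp_MBI MBI_imp_uniform_SGC by blast
  show "max_MBI \<Gamma>" if "MBI \<Gamma>"
    using MBI_imp_max_MBI[OF gain that] .
  show "UGS (augmented \<Gamma>)" if "max_MBI \<Gamma>"
    using max_MBI_imp_UGS[OF gain that] .
  \<comment> \<open>The \<open>\<oplus>\<close>-MBI property also excludes non-zero fixed points, by
    way of SGC; together with UGS this gives attractivity.\<close>
  then show "componentwise_attractive \<Gamma>" if "max_MBI \<Gamma>"
    using that max_MBI_imp_SGC SGC_imp_no_nonzero_fixed_points
      UGS_no_fixed_points_imp_attractive[OF gain] by blast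
  show "UGS (augmented \<Gamma>) \<and> componentwise_attractive \<Gamma> \<longleftrightarrow> UGS (augmented \<Gamma>) \<and> SGC \<Gamma>"
    and "UGS (augmented \<Gamma>) \<and> SGC \<Gamma> \<longleftrightarrow> UGS (augmented \<Gamma>) \<and> no_nonzero_fixed_points \<Gamma>"
    using attractive_imp_SGC[OF gain] SGC_imp_no_nonzero_fixed_points
      UGS_no_fixed_points_imp_attractive[OF gain] by blast+
next
  show "\<exists>I \<gamma> \<mu> \<Gamma>. is_gain_operator I \<gamma> \<mu> \<Gamma> \<and> max_MBI \<Gamma> \<and> \<not> MBI \<Gamma>"
    by (intro exI conjI) (rule quad_shift_gain_operator quad_shift_max_MBI quad_shift_not_MBI)+
qed

end
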